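(* Let $U$ be an ultrafilter over a set $I$ and $V$ an ultrafilter over a set $J$. Then the following are equivalent: (1) there exists a Chu transform from $\langle U,\supseteq,U\rangle$ to $\langle V,\supseteq,V\rangle$; (2) $U\le_\mathrm{RK}V$.
   Context: A Chu space is a triple $\langle X,r,A\rangle$ with $r\subseteq X\times A$; here $\langle U,\supseteq,U\rangle$ has points and states both equal to $U$ and relation $\{\langle X_0,X_1\rangle\in U\times U: X_0\supseteq X_1\}$. A Chu transform from $\langle X,r,A\rangle$ to $\langle Y,s,B\rangle$ is a pair $f\colon X\to Y$, $g\colon B\to A$ with $\langle x,g(b)\rangle\in r\iff\langle f(x),b\rangle\in s$ for all $x\in X$, $b\in B$. For ultrafilters $U$ over $I$ and $V$ over $J$, $U\le_\mathrm{RK}V$ (Rudin–Keisler reducibility) means there is a function $h\colon J\to I$ such that for every $X\subseteq I$, $X\in U\iff h^{-1}[X]\in V$. *)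

theory Defs
  imports "HOL-Library.FuncSet"
begin

definition filter_over :: "'a set \<Rightarrow> 'a set set \<Rightarrow> bool" where
  "filter_over I F \<longleftrightarrow>
     F \<subseteq> Pow I \<and> I \<in> F \<and>
     (\<forall>X\<in>F. \<forall>Y\<in>F. X \<inter> Y \<in> F) \<and>
     (\<forall>X\<in>F. \<forall>Y. X \<subseteq> Y \<and> Y \<subseteq> I \<longrightarrow> Y \<in> F)"

text \<open>Principal ultrafilters are allowed. Since an ultrafilter is proper, there is
  none over the empty set.\<close>

definition ultrafilter_over :: "'a set \<Rightarrow> 'a set set \<Rightarrow> bool" where
  "ultrafilter_over I U \<longleftrightarrow>
     filter_over I U \<and> {} \<notin> U \<and> (\<forall>X\<subseteq>I. X \<in> U \<or> I - X \<in> U)"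

text \<open>A triple \<open>(X, r, A)\<close>: points, relation, states.\<close>

type_synonym ('x, 'a) chu = "'x set \<times> ('x \<times> 'a) set \<times> 'a set"

definition chu_space :: "('x, 'a) chu \<Rightarrow> bool" where
  "chu_space = (\<lambda>(X, r, A). r \<subseteq> X \<times> A)"

text \<open>Functions between carrier sets are total functions on the underlying types;
  only their values on the carriers matter.\<close>

definition chu_transform ::
  "('x, 'a) chu \<Rightarrow> ('y, 'b) chu \<Rightarrow> ('x \<Rightarrow> 'y) \<Rightarrow> ('b \<Rightarrow> 'a) \<Rightarrow> bool" where
  "chu_transform = (\<lambda>(X, r, A) (Y, s, B) f g.
     f \<in> X \<rightarrow> Y \<and> g \<in> B \<rightarrow> A \<and>
     (\<forall>x\<in>X. \<forall>b\<in>B. (x, g b) \<in> r \<longleftrightarrow> (f x, b) \<in> s))"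

definition supset_chu :: "'a set set \<Rightarrow> ('a set, 'a set) chu" where
  "supset_chu U = (U, {(X0, X1). X0 \<in> U \<and> X1 \<in> U \<and> X0 \<supseteq> X1}, U)"

lemma chu_space_supset_chu: "chu_space (supset_chu U)"
  by (auto simp: chu_space_def supset_chu_def)

definition RK_le :: "'a set \<Rightarrow> 'a set set \<Rightarrow> 'b set \<Rightarrow> 'b set set \<Rightarrow> bool" where
  "RK_le I U J V \<longleftrightarrow>
     (\<exists>h. h \<in> J \<rightarrow> I \<and> (\<forall>X\<subseteq>I. X \<in> U \<longleftrightarrow> h -` X \<inter> J \<in> V))"

end

theory Submission
  imports Defs
begin

text \<open>A Chu transform \<open>(f, g)\<close> is a Galois connection: \<open>g b \<subseteq> X \<longleftrightarrow> b \<subseteq> f X\<close>. From a reduction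
  \<open>h\<close> one takes the preimage and image maps. Conversely, if \<open>U\<close> is principal, a constant
  function reduces it to \<open>V\<close>. Otherwise \<open>I - {i} \<in> U\<close> for all \<open>i\<close>, and any \<open>h\<close> choosing
  \<open>h j\<close> among the \<open>i\<close> with \<open>j \<notin> f (I - {i})\<close> satisfies \<open>f X \<subseteq> h -` X\<close> on the set of \<open>j\<close>
  where such an \<open>i\<close> exists. That set is in \<open>V\<close>: if its complement \<open>b\<close> were in \<open>V\<close>, then
  \<open>b \<subseteq> f (I - {i})\<close>, hence \<open>i \<notin> g b\<close>, for every \<open>i\<close>, and \<open>g b\<close> would be empty.\<close>

lemma filter_over_subset: "filter_over I F \<Longrightarrow> X \<in> F \<Longrightarrow> X \<subseteq> I"
  unfolding filter_over_def by (elim conjE) (drule (1) subsetD, simp)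

lemma filter_over_top: "filter_over I F \<Longrightarrow> I \<in> F"
  unfolding filter_over_def by simp

lemma filter_over_Int: "filter_over I F \<Longrightarrow> X \<in> F \<Longrightarrow> Y \<in> F \<Longrightarrow> X \<inter> Y \<in> F"
  unfolding filter_over_def by simp

lemma filter_over_mono: "filter_over I F \<Longrightarrow> X \<in> F \<Longrightarrow> X \<subseteq> Y \<Longrightarrow> Y \<subseteq> I \<Longrightarrow> Y \<in> F"
  unfolding filter_over_def by (elim conjE) (drule (1) bspec, simp)

lemma ultrafilter_over_filter: "ultrafilter_over I U \<Longrightarrow> filter_over I U"
  unfolding ultrafilter_over_def by blast

lemma ultrafilter_over_empty: "ultrafilter_over I U \<Longrightarrow> {} \<notin> U"
  unfolding ultrafilter_over_def by blast

lemma ultrafilter_over_compl: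
  assumes "ultrafilter_over I U" and "X \<subseteq> I"
  shows "I - X \<in> U \<longleftrightarrow> X \<notin> U"
proof -
  have "False" if "X \<in> U" "I - X \<in> U"
    using filter_over_Int[OF ultrafilter_over_filter[OF assms(1)] that]
      ultrafilter_over_empty[OF assms(1)] by simp
  then show ?thesis
    using assms unfolding ultrafilter_over_def by metis
qed

text \<open>Preimages along \<open>h\<close> commute with complements, and \<open>V\<close> cannot
  contain both a set and its complement, so the converse implication comes for free.\<close>

lemma RK_leI:
  assumes U: "ultrafilter_over I U" and V: "ultrafilter_over J V"
    and h: "h \<in> J \<rightarrow> I" and "\<And>X. X \<in> U \<Longrightarrow> h -` X \<inter> J \<in> V"
  shows "RK_le I U J V"
proof -
  have "X \<in> U" if "X \<subseteq> I" "h -` X \<inter> J \<in> V" for X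
  proof (rule ccontr)
    assume "X \<notin> U"
    then have "h -` (I - X) \<inter> J \<in> V"
      using assms(4) ultrafilter_over_compl[OF U \<open>X \<subseteq> I\<close>] by blast
    moreover have "h -` (I - X) \<inter> J = J - (h -` X \<inter> J)"
      using h by blast
    ultimately show False
      using that(2) ultrafilter_over_compl[OF V, of "h -` X \<inter> J"] by simp
  qed
  then show ?thesis
    unfolding RK_le_def using h assms(4) by (intro exI[of _ h]) auto
qed

text \<open>The typing of \<open>f\<close> and \<open>g\<close> already gives the membership
  conditions in both relations, so only the inclusions remain.\<close>

lemma chu_transform_supset_chu_iff:
  "chu_transform (supset_chu U) (supset_chu V) f g \<longleftrightarrow>
     f \<in> U \<rightarrow> V \<and> g \<in> V \<rightarrow> U \<and> (\<forall>X\<in>U. \<forall>b\<in>V. g b \<subseteq> X \<longleftrightarrow> b \<subseteq> f X)"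
  unfolding chu_transform_def supset_chu_def by (simp add: Pi_iff cong: conj_cong)

lemma RK_le_imp_chu_transform:
  assumes U: "filter_over I U" and V: "filter_over J V" and "RK_le I U J V"
  shows "\<exists>f g. chu_transform (supset_chu U) (supset_chu V) f g"
proof -
  obtain h where h: "h \<in> J \<rightarrow> I" and iff: "\<And>X. X \<subseteq> I \<Longrightarrow> X \<in> U \<longleftrightarrow> h -` X \<inter> J \<in> V"
    using assms(3) unfolding RK_le_def by blast
  \<comment> \<open>The preimage of the image of \<open>b\<close> contains \<open>b\<close>, hence
    lies in \<open>V\<close>.\<close>
  have "h ` b \<in> U" if b: "b \<in> V" for b
  proof -
    have "b \<subseteq> J" using filter_over_subset[OF V b] .
    moreover have "h -` (h ` b) \<inter> J \<in> V"
      using \<open>b \<subseteq> J\<close> by (intro filter_over_mono[OF V b]) auto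
    ultimately show ?thesis
      using iff[of "h ` b"] h by blast
  qed
  moreover have "h -` X \<inter> J \<in> V" if "X \<in> U" for X
    using iff filter_over_subset[OF U that] that by blast
  moreover have "h ` b \<subseteq> X \<longleftrightarrow> b \<subseteq> h -` X \<inter> J" if "b \<in> V" for b X
    using filter_over_subset[OF V that] by blast
  ultimately have "chu_transform (supset_chu U) (supset_chu V) (\<lambda>X. h -` X \<inter> J) (\<lambda>b. h ` b)"
    unfolding chu_transform_supset_chu_iff by (simp add: Pi_iff)
  then show ?thesis by blast
qed

text \<open>Handled separately because here \<open>I - {i}\<close> is not in \<open>U\<close>, where
  the Galois connection says nothing about \<open>f\<close>. Every member of \<open>U\<close>
  contains \<open>i\<close>.\<close>

lemma RK_le_principal:
  assumes U: "ultrafilter_over I U" and V: "ultrafilter_over J V" and i: "{i} \<in> U"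
  shows "RK_le I U J V"
proof (rule RK_leI[OF U V])
  show "(\<lambda>_. i) \<in> J \<rightarrow> I"
    using filter_over_subset[OF ultrafilter_over_filter[OF U] i] by simp
next
  fix X assume "X \<in> U"
  then have "X \<inter> {i} \<in> U"
    using filter_over_Int[OF ultrafilter_over_filter[OF U]] i by blast
  then have "i \<in> X"
    using ultrafilter_over_empty[OF U] by (cases "i \<in> X") auto
  then show "(\<lambda>_. i) -` X \<inter> J \<in> V"
    using filter_over_top[OF ultrafilter_over_filter[OF V]] by simp
qed

lemma chu_transform_imp_RK_le:
  assumes U: "ultrafilter_over I U" and V: "ultrafilter_over J V"
    and "chu_transform (supset_chu U) (supset_chu V) f g"
  shows "RK_le I U J V"
proof (cases "\<exists>i. {i} \<in> U")
  case True
  then show ?thesis using RK_le_principal[OF U V] by blast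
next
  case False
  note filtU = ultrafilter_over_filter[OF U]
  note filtV = ultrafilter_over_filter[OF V]
  have f: "\<And>X. X \<in> U \<Longrightarrow> f X \<in> V" and g: "\<And>b. b \<in> V \<Longrightarrow> g b \<in> U"
    and galois: "\<And>X b. X \<in> U \<Longrightarrow> b \<in> V \<Longrightarrow> g b \<subseteq> X \<longleftrightarrow> b \<subseteq> f X"
    using assms(3) unfolding chu_transform_supset_chu_iff by blast+
  have f_mono: "f X \<subseteq> f Y" if "X \<in> U" "Y \<in> U" "X \<subseteq> Y" for X Y
  proof -
    \<comment> \<open>The Galois connection at \<open>b = f X\<close>.\<close>
    have "g (f X) \<subseteq> X" using galois[OF that(1) f[OF that(1)]] by simp
    then show ?thesis using galois[OF that(2) f[OF that(1)]] that(3) by (metis order_trans)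
  qed
  have co: "I - {i} \<in> U" if "i \<in> I" for i
    using False ultrafilter_over_compl[OF U, of "{i}"] that by simp
  \<comment> \<open>If \<open>f\<close> is the preimage map of some \<open>h\<close> from
    \<open>J\<close> to \<open>I\<close>, then \<open>R j = {h j}\<close> for \<open>j\<close> in
    \<open>J\<close>.\<close>
  define R where "R j = {i \<in> I. j \<notin> f (I - {i})}" for j
  define D where "D = {j \<in> J. R j \<noteq> {}}"
  have "D \<in> V"
  proof (rule ccontr)
    assume "D \<notin> V"
    then have b: "J - D \<in> V"
      using ultrafilter_over_compl[OF V, of D] unfolding D_def by blast
    then obtain i where i: "i \<in> g (J - D)"
      using g ultrafilter_over_empty[OF U] by (metis equals0I)
    then have "i \<in> I" using filter_over_subset[OF filtU g[OF b]] by blast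
    then have "J - D \<subseteq> f (I - {i})"
      unfolding D_def R_def by blast
    then show False
      using galois[OF co[OF \<open>i \<in> I\<close>] b] i by blast
  qed
  obtain k where k: "k \<in> I"
    using filter_over_top[OF filtU] ultrafilter_over_empty[OF U] by (metis equals0I)
  \<comment> \<open>The default \<open>k\<close> only keeps the values in \<open>I\<close>; off
    \<open>D \<in> V\<close> they are irrelevant.\<close>
  define h where "h j = (if j \<in> D then SOME i. i \<in> R j else k)" for j
  have hR: "h j \<in> R j" if "j \<in> D" for j
    using that unfolding h_def D_def by (simp add: some_in_eq)
  show ?thesis
  proof (rule RK_leI[OF U V])
    have "h j \<in> I" for j
      using hR k by (cases "j \<in> D") (auto simp: R_def h_def)
    then show "h \<in> J \<rightarrow> I" by simp
  next
    fix X assume X: "X \<in> U"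
    \<comment> \<open>Otherwise \<open>X \<subseteq> I - {h j}\<close>, and monotonicity of
      \<open>f\<close> puts \<open>j\<close> into \<open>f (I - {h j})\<close>, against the choice
      of \<open>h j\<close>.\<close>
    have "h j \<in> X" if j: "j \<in> f X" "j \<in> D" for j
    proof (rule ccontr)
      assume "h j \<notin> X"
      moreover have "h j \<in> I" "j \<notin> f (I - {h j})"
        using hR[OF j(2)] unfolding R_def by auto
      ultimately show False
        using f_mono[OF X co] filter_over_subset[OF filtU X] j(1) by blast
    qed
    then have "f X \<inter> D \<subseteq> h -` X \<inter> J"
      unfolding D_def by blast
    then show "h -` X \<inter> J \<in> V"
      using filter_over_mono[OF filtV filter_over_Int[OF filtV f[OF X] \<open>D \<in> V\<close>]] by blast
  qed
qed

theorem theorem5p4: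
  fixes I :: "'a set" and U :: "'a set set" and J :: "'b set" and V :: "'b set set"
  assumes "ultrafilter_over I U" and "ultrafilter_over J V"
  shows "(\<exists>f g. chu_transform (supset_chu U) (supset_chu V) f g) \<longleftrightarrow> RK_le I U J V"
  using chu_transform_imp_RK_le[OF assms] RK_le_imp_chu_transform[OF assms[THEN ultrafilter_over_filter]]
  by blast

end
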